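(* Let $V$ be a fixed $v$-set and let $\Omega$ be a family of $v$ distinct non-empty subsets of $V$. (a) Suppose $\Omega=\Omega_0,\Omega_1,\dots,\Omega_n=\Omega'$ is a sequence of families with $\Omega_i=h_i(\Omega_{i-1})$ for $i=1,\dots,n$, where each $h_i$ equals $g$ or equals $f_{A_i}$ for some $A_i\in\Omega_{i-1}$ (so that each function is defined on the family to which it is applied). Then $\Omega'=g(\Omega)=\Omega$ or $\Omega'=f_A(\Omega)$ for some $A\in\Omega$. (b) Let $\mathbf{X}$ be the set of all families $\Omega'$ that can be obtained from $\Omega$ by a finite sequence of functions as in part (a), and let $\mathbf{Y}$ be the set of all families $\Omega''$ of the form $\Omega''=h(\Omega)$ where $h=g$ or $h=f_A$ for some $A\in\Omega$. Then $\mathbf{X}=\mathbf{Y}$. (c) For two families $\Omega$ and $\Sigma$ of $v$ distinct non-empty subsets of $V$, write $\Sigma\sim\Omega$ if $\Sigma=h(\Omega)$ where $h=g$ or $h=f_A$ for some $A\in\Omega$. Then $\sim$ is an equivalence relation.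
   Context: $A\bigtriangleup B$ denotes symmetric difference. For a family $\Omega$ of $v$ distinct non-empty subsets of the $v$-set $V$ (members of $\Omega$ are called its blocks) and a block $A\in\Omega$, the block complementation $f_A$ with respect to $A$ is the function on $\Omega$ defined by $f_A(A)=A$ and $f_A(B)=A\bigtriangleup B$ for all $B\in\Omega$, $B\neq A$; $f_A$ is not defined on $\Omega$ if $A\notin\Omega$. The image $f_A(\Omega)=\{f_A(B):B\in\Omega\}$ is again a family of $v$ distinct non-empty subsets of $V$. The function $g$ is the identity function, $g(B)=B$ for every $B\in\Omega$, and it is defined on every family $\Omega$; thus $g(\Omega)=\Omega$. *)

theory Defs
  imports Main
begin

text \<open>
  A family of v distinct non-empty subsets of V is a set of sets of cardinality v (blocks are
  automatically distinct).
\<close>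
definition block_family :: "nat \<Rightarrow> 'a set \<Rightarrow> 'a set set \<Rightarrow> bool" where
  "block_family v V \<Omega> \<longleftrightarrow> (\<forall>B\<in>\<Omega>. B \<subseteq> V \<and> B \<noteq> {}) \<and> finite \<Omega> \<and> card \<Omega> = v"

text \<open>
  \<open>block_compl A\<close> is the function f_A. It is a total HOL function on sets; the proviso that f_A is
  defined on \<open>\<Omega>\<close> only when A is a block of \<open>\<Omega>\<close> is carried by \<open>block_ops\<close>, the set of functions
  (f_A or the identity g) that are defined on \<open>\<Omega>\<close>.
\<close>
definition block_compl :: "'a set \<Rightarrow> 'a set \<Rightarrow> 'a set" where
  "block_compl A B = (if B = A then A else sym_diff A B)"

definition block_ops :: "'a set set \<Rightarrow> ('a set \<Rightarrow> 'a set) set" where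
  "block_ops \<Omega> = {h. h = id \<or> (\<exists>A\<in>\<Omega>. h = block_compl A)}"

definition op_sequence ::
  "nat \<Rightarrow> (nat \<Rightarrow> 'a set \<Rightarrow> 'a set) \<Rightarrow> (nat \<Rightarrow> 'a set set) \<Rightarrow> 'a set set \<Rightarrow> 'a set set \<Rightarrow> bool" where
  "op_sequence n h \<Omega>s \<Omega> \<Omega>' \<longleftrightarrow>
     \<Omega>s 0 = \<Omega> \<and> \<Omega>s n = \<Omega>' \<and>
     (\<forall>i\<in>{1..n}. h i \<in> block_ops (\<Omega>s (i - 1)) \<and> \<Omega>s i = h i ` \<Omega>s (i - 1))"

definition reachable_families :: "'a set set \<Rightarrow> 'a set set set" where
  "reachable_families \<Omega> = {\<Omega>'. \<exists>n h \<Omega>s. op_sequence n h \<Omega>s \<Omega> \<Omega>'}"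

definition one_step_families :: "'a set set \<Rightarrow> 'a set set set" where
  "one_step_families \<Omega> = {\<Omega>''. \<exists>h\<in>block_ops \<Omega>. \<Omega>'' = h ` \<Omega>}"

definition family_rel :: "nat \<Rightarrow> 'a set \<Rightarrow> ('a set set \<times> 'a set set) set" where
  "family_rel v V = {(\<Sigma>, \<Omega>). block_family v V \<Sigma> \<and> block_family v V \<Omega> \<and>
     (\<exists>h\<in>block_ops \<Omega>. \<Sigma> = h ` \<Omega>)}"

text \<open>
  The image of a family is again a family, so the terms of an \<open>op_sequence\<close> starting at a family
  need not be required to be families.
\<close>
lemma block_family_image:
  assumes "block_family v V \<Omega>" and "h \<in> block_ops \<Omega>"
  shows "block_family v V (h ` \<Omega>)"
proof (cases "h = id")
  case True
  then show ?thesis using assms by simp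
next
  case False
  then obtain A where A: "A \<in> \<Omega>" and h: "h = block_compl A"
    using assms(2) by (auto simp: block_ops_def)
  have ne: "B \<noteq> {}" and sub: "B \<subseteq> V" if "B \<in> \<Omega>" for B
    using that assms(1) by (auto simp: block_family_def)
  have "inj_on h \<Omega>"
  proof (rule inj_onI)
    fix B C assume "B \<in> \<Omega>" "C \<in> \<Omega>" "h B = h C"
    then show "B = C"
      using ne[of B] ne[of C] unfolding h block_compl_def by (auto split: if_splits)
  qed
  then have "card (h ` \<Omega>) = v"
    using assms(1) by (simp add: card_image block_family_def)
  moreover have "h B \<subseteq> V \<and> h B \<noteq> {}" if "B \<in> \<Omega>" for B
    using ne[OF that] sub[OF that] sub[OF A] unfolding h block_compl_def by auto
  ultimately show ?thesis
    using assms(1) by (auto simp: block_family_def)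
qed

end

theory Submission
  imports Defs
begin

text \<open>
  Adjoin the empty set to \<open>\<Omega>\<close>. Then \<open>f_A\<close> becomes translation by A in the elementary abelian
  2-group of subsets of V under symmetric difference, and g becomes translation by the empty set.
  So the families obtained from \<open>\<Omega>\<close> in one step are the translates of \<open>insert {} \<Omega>\<close> by its own
  elements, with the empty set removed again. Translating by \<open>sym_diff A D\<close> after translating by A
  is translating by D, which gives transitivity; D empty gives symmetry.
\<close>

definition translate :: "'a set \<Rightarrow> 'a set set \<Rightarrow> 'a set set" where
  "translate A \<Omega> = sym_diff A ` insert {} \<Omega> - {{}}"

lemma sym_diff_cancel_left: "sym_diff (sym_diff A D) (sym_diff A B) = sym_diff D B"
  by blast

lemma translate_empty:
  assumes "{} \<notin> \<Omega>"
  shows "translate {} \<Omega> = \<Omega>"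
  using assms by (auto simp: translate_def)

lemma translate_block:
  assumes "{} \<notin> \<Omega>" and "A \<in> \<Omega>"
  shows "translate A \<Omega> = block_compl A ` \<Omega>"
proof -
  have A: "A \<noteq> {}" using assms by blast
  have eq_empty: "sym_diff A B = {} \<longleftrightarrow> B = A" for B by blast
  have "insert {} \<Omega> = insert {} (insert A (\<Omega> - {A}))" using assms by blast
  then have "translate A \<Omega> = insert A (sym_diff A ` (\<Omega> - {A})) - {{}}"
    unfolding translate_def by (simp only: image_insert) auto
  \<comment> \<open>Only A is translated to the empty set, so removing the empty set loses nothing
    from the blocks other than A.\<close>
  also have "\<dots> = insert A (sym_diff A ` (\<Omega> - {A}))"
    using A eq_empty by blast
  also have "\<dots> = insert (block_compl A A) (block_compl A ` (\<Omega> - {A}))"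
    by (intro arg_cong2[where f = insert] image_cong) (auto simp: block_compl_def)
  also have "\<dots> = block_compl A ` \<Omega>" using assms(2) by blast
  finally show ?thesis .
qed

lemma one_step_families_alt:
  "one_step_families \<Omega> = insert \<Omega> ((\<lambda>A. block_compl A ` \<Omega>) ` \<Omega>)"
  by (auto simp: one_step_families_def block_ops_def)

lemma one_step_families_translate:
  assumes "{} \<notin> \<Omega>"
  shows "one_step_families \<Omega> = (\<lambda>A. translate A \<Omega>) ` insert {} \<Omega>"
  using assms by (simp add: one_step_families_alt translate_empty translate_block cong: image_cong)

text \<open>As A lies in \<open>insert {} \<Omega>\<close>, its own translate
  \<open>sym_diff A A\<close> puts the empty set into the image; removing it and adjoining it again
  therefore changes nothing.\<close>

lemma insert_empty_translate:
  assumes "A \<in> insert {} \<Omega>"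
  shows "insert {} (translate A \<Omega>) = sym_diff A ` insert {} \<Omega>"
proof -
  have "{} \<in> sym_diff A ` insert {} \<Omega>"
    using assms by (intro image_eqI[where x = A]) auto
  then show ?thesis unfolding translate_def by blast
qed

lemma translate_translate:
  assumes "A \<in> insert {} \<Omega>"
  shows "translate (sym_diff A D) (translate A \<Omega>) = translate D \<Omega>"
  by (simp only: translate_def[of "sym_diff A D"] insert_empty_translate[OF assms]
      image_image sym_diff_cancel_left translate_def[of D])

lemma one_step_families_trans:
  assumes "{} \<notin> \<Omega>" and "\<Sigma> \<in> one_step_families \<Omega>" and "\<Theta> \<in> one_step_families \<Sigma>"
  shows "\<Theta> \<in> one_step_families \<Omega>"
proof -
  obtain A where A: "A \<in> insert {} \<Omega>" and \<Sigma>: "\<Sigma> = translate A \<Omega>"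
    using assms(2) unfolding one_step_families_translate[OF assms(1)] by blast
  \<comment> \<open>A translate omits the empty set by construction, so the description by
    translations applies to \<Sigma> too.\<close>
  have "{} \<notin> \<Sigma>" by (simp add: \<Sigma> translate_def)
  from one_step_families_translate[OF this] obtain C where C: "C \<in> insert {} \<Sigma>" and \<Theta>: "\<Theta> = translate C \<Sigma>"
    using assms(3) by blast
  \<comment> \<open>With the empty set adjoined, \<Sigma> is the full image under translation by A,
    so C has a preimage D there.\<close>
  obtain D where D: "D \<in> insert {} \<Omega>" and "C = sym_diff A D"
    using C unfolding \<Sigma> insert_empty_translate[OF A] by (elim imageE)
  then have "\<Theta> = translate D \<Omega>" by (simp only: \<Theta> \<Sigma> translate_translate[OF A])
  then show ?thesis using D one_step_families_translate[OF assms(1)] by blast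
qed

lemma one_step_families_sym:
  assumes "{} \<notin> \<Omega>" and "\<Sigma> \<in> one_step_families \<Omega>"
  shows "\<Omega> \<in> one_step_families \<Sigma>"
proof -
  obtain A where A: "A \<in> insert {} \<Omega>" and \<Sigma>: "\<Sigma> = translate A \<Omega>"
    using assms(2) unfolding one_step_families_translate[OF assms(1)] by blast
  have "{} \<notin> \<Sigma>" by (simp add: \<Sigma> translate_def)
  \<comment> \<open>A is the translate of the adjoined empty set.\<close>
  moreover have "A \<in> insert {} \<Sigma>"
    unfolding \<Sigma> insert_empty_translate[OF A] by (rule image_eqI[where x = "{}"]) auto
  \<comment> \<open>A is its own inverse: \<open>sym_diff A {}\<close> is A, and translating by the
    empty set gives back \<Omega>.\<close>
  moreover have "\<Omega> = translate A \<Sigma>"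
    using translate_translate[OF A, of "{}"] by (simp add: \<Sigma> translate_empty assms(1))
  ultimately show ?thesis using one_step_families_translate by blast
qed

lemma op_sequence_one_step:
  assumes "{} \<notin> \<Omega>" and "op_sequence n h \<Omega>s \<Omega> \<Omega>'"
  shows "\<Omega>' \<in> one_step_families \<Omega>"
proof -
  have "\<Omega>s i \<in> one_step_families \<Omega>" if "i \<le> n" for i
    using that
  proof (induction i)
    case 0
    then show ?case using assms(2) by (simp add: op_sequence_def one_step_families_alt)
  next
    case (Suc i)
    \<comment> \<open>Operations are numbered from 1, so the one numbered \<open>Suc i\<close> acts
      on the family with index i.\<close>
    have "Suc i \<in> {1..n}" using Suc.prems by simp
    then have "h (Suc i) \<in> block_ops (\<Omega>s i)" "\<Omega>s (Suc i) = h (Suc i) ` \<Omega>s i"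
      using assms(2) unfolding op_sequence_def by (metis diff_Suc_1)+
    then have "\<Omega>s (Suc i) \<in> one_step_families (\<Omega>s i)"
      by (auto simp: one_step_families_def)
    with Suc show ?case using one_step_families_trans[OF assms(1)] by simp
  qed
  then show ?thesis using assms(2) by (auto simp: op_sequence_def)
qed

lemma reachable_families_eq_one_step:
  assumes "{} \<notin> \<Omega>"
  shows "reachable_families \<Omega> = one_step_families \<Omega>"
proof
  show "reachable_families \<Omega> \<subseteq> one_step_families \<Omega>"
    using op_sequence_one_step[OF assms] by (auto simp: reachable_families_def)
  show "one_step_families \<Omega> \<subseteq> reachable_families \<Omega>"
  proof
    fix \<Sigma> assume "\<Sigma> \<in> one_step_families \<Omega>"
    then obtain k where "k \<in> block_ops \<Omega>" "\<Sigma> = k ` \<Omega>"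
      by (auto simp: one_step_families_def)
    \<comment> \<open>For length 1 only the operation with index 1 is consulted, so a constant
      sequence of operations serves.\<close>
    then have "op_sequence 1 (\<lambda>_. k) (\<lambda>i. if i = 0 then \<Omega> else \<Sigma>) \<Omega> \<Sigma>"
      by (simp add: op_sequence_def)
    then show "\<Sigma> \<in> reachable_families \<Omega>" unfolding reachable_families_def by blast
  qed
qed

lemma block_family_empty_notin: "block_family v V \<Omega> \<Longrightarrow> {} \<notin> \<Omega>"
  by (auto simp: block_family_def)

lemma family_rel_iff:
  "(\<Sigma>, \<Omega>) \<in> family_rel v V \<longleftrightarrow>
     block_family v V \<Sigma> \<and> block_family v V \<Omega> \<and> \<Sigma> \<in> one_step_families \<Omega>"
  by (simp add: family_rel_def one_step_families_def)

lemma equiv_family_rel: "equiv {\<Omega>. block_family v V \<Omega>} (family_rel v V)"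
proof (rule equivI)
  show "family_rel v V \<subseteq> {\<Omega>. block_family v V \<Omega>} \<times> {\<Omega>. block_family v V \<Omega>}"
    by (auto simp: family_rel_def)
  show "refl_on {\<Omega>. block_family v V \<Omega>} (family_rel v V)"
    by (auto simp: refl_on_def family_rel_iff one_step_families_alt)
  show "sym (family_rel v V)"
    by (rule symI) (metis family_rel_iff one_step_families_sym block_family_empty_notin)
  \<comment> \<open>In a pair the first family arises from the second, so a chain of two pairs
    starts at its last family.\<close>
  show "trans (family_rel v V)"
    by (rule transI) (metis family_rel_iff one_step_families_trans block_family_empty_notin)
qed

theorem theorem2p4:
  fixes V :: "'a set" and v :: nat
  assumes "finite V" and "card V = v"
  shows "(\<forall>\<Omega>. block_family v V \<Omega> \<longrightarrow>
            (\<forall>n h \<Omega>s \<Omega>'. op_sequence n h \<Omega>s \<Omega> \<Omega>' \<longrightarrow>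
               (\<Omega>' = id ` \<Omega> \<and> id ` \<Omega> = \<Omega>) \<or> (\<exists>A\<in>\<Omega>. \<Omega>' = block_compl A ` \<Omega>)) \<and>
            reachable_families \<Omega> = one_step_families \<Omega>) \<and>
         equiv {\<Omega>. block_family v V \<Omega>} (family_rel v V)"
proof (intro conjI allI impI)
  fix \<Omega> :: "'a set set" assume "block_family v V \<Omega>"
  then have ne: "{} \<notin> \<Omega>" by (rule block_family_empty_notin)
  show "reachable_families \<Omega> = one_step_families \<Omega>"
    using ne by (rule reachable_families_eq_one_step)
  fix n h \<Omega>s \<Omega>' assume "op_sequence n h \<Omega>s \<Omega> \<Omega>'"
  then have "\<Omega>' \<in> one_step_families \<Omega>" by (rule op_sequence_one_step[OF ne])
  then show "(\<Omega>' = id ` \<Omega> \<and> id ` \<Omega> = \<Omega>) \<or> (\<exists>A\<in>\<Omega>. \<Omega>' = block_compl A ` \<Omega>)"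
    by (auto simp: one_step_families_alt)
qed (rule equiv_family_rel)

end
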